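(* Let $G$ be a ribbon graph with dual $G^*$. Identify the topological medial graphs $G_m$ and $G^*_m$ (which are the same embedded graph). Then $$Q(G^*_m;W(G^*_m),t)=Q(G_m;W^*(G_m),t),$$ where $W(G^*_m)$ is the medial weight system of $G^*_m$ relative to $G^*$, and $W^*(G_m)$ is the dual weight system of $G_m$ relative to $G$.
   Context: A ribbon graph $G$ is a graph cellularly embedded in a surface; $G^*$ is its geometric dual in the same surface. The topological medial graph $G_m$ has a vertex on each edge of $G$ and edges running around the faces of $G$ between consecutive half-edges; $G_m$ and $G^*_m$ coincide as embedded graphs, each vertex of $G_m$ lying on an edge $e$ of $G$ and the dual edge $e^*$ of $G^*$. The medial weight system $W$ of $G_m$ relative to $G$ assigns to a pair of $G_m$-half-edges at a vertex on $e$ the weight $\sqrt\alpha$ if they are consecutive in the rotation with no half-edge of $e$ between them, $\sqrt\beta$ if consecutive with a half-edge of $e$ between them, and $0$ otherwise; so the "uncut" vertex state (leaving the ribbon of $e$ intact) has weight $\alpha$ and the "cut" state weight $\beta$. The dual weight system $W^*$ is obtained by exchanging the roles of $\alpha$ and $\beta$. A graph state $S$ chooses a pairing of half-edges at each vertex; $\omega(S)$ is the product of the pair weights, $c(S)$ the number of resulting closed curves, and $Q(G_m;W,t)=\sum_S\omega(S)t^{c(S)}$. *)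

theory Defs
  imports "HOL-Library.Disjoint_Sets" "HOL-Library.FuncSet"
begin

text \<open>
  Cellularly embedded graphs, in orientable or non-orientable surfaces, are given by their
  flags (an end of an edge together with one of its two sides).
  Each flag \<open>x\<close> has three neighbours: \<open>vflip x\<close> differs from \<open>x\<close> only in the vertex, \<open>eflip x\<close>
  only in the edge and \<open>fflip x\<close> only in the face. Vertices, edges and faces are the orbits of
  \<open>{eflip, fflip}\<close>, \<open>{vflip, fflip}\<close> and \<open>{vflip, eflip}\<close>. The surface is obtained by gluing
  a triangle for each flag along these three involutions.
\<close>

record 'f embedded_graph =
  flags :: "'f set"
  vflip :: "'f \<Rightarrow> 'f"
  eflip :: "'f \<Rightarrow> 'f"
  fflip :: "'f \<Rightarrow> 'f"

locale embedded_graph =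
  fixes G :: "('f, 'm) embedded_graph_scheme"
  assumes finite_flags: "finite (flags G)"
    and vflip_flags: "x \<in> flags G \<Longrightarrow> vflip G x \<in> flags G"
    and eflip_flags: "x \<in> flags G \<Longrightarrow> eflip G x \<in> flags G"
    and fflip_flags: "x \<in> flags G \<Longrightarrow> fflip G x \<in> flags G"
    and vflip_vflip: "x \<in> flags G \<Longrightarrow> vflip G (vflip G x) = x"
    and eflip_eflip: "x \<in> flags G \<Longrightarrow> eflip G (eflip G x) = x"
    and fflip_fflip: "x \<in> flags G \<Longrightarrow> fflip G (fflip G x) = x"
    and vflip_neq: "x \<in> flags G \<Longrightarrow> vflip G x \<noteq> x"
    and eflip_neq: "x \<in> flags G \<Longrightarrow> eflip G x \<noteq> x"
    and fflip_neq: "x \<in> flags G \<Longrightarrow> fflip G x \<noteq> x"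
    and vflip_fflip: "x \<in> flags G \<Longrightarrow> vflip G (fflip G x) = fflip G (vflip G x)"
    and vflip_neq_fflip: "x \<in> flags G \<Longrightarrow> vflip G x \<noteq> fflip G x"

text \<open>
  A vertex without incident edges carries no flags, so the components consisting of an isolated
  vertex (embedded in a sphere) are counted separately.
\<close>

record 'f ribbon_graph = "'f embedded_graph" +
  isolated :: nat

definition dual :: "'f ribbon_graph \<Rightarrow> 'f ribbon_graph" where
  "dual G = G\<lparr>vflip := fflip G, fflip := vflip G\<rparr>"

definition half_edge :: "('f, 'm) embedded_graph_scheme \<Rightarrow> 'f \<Rightarrow> 'f set" where
  "half_edge G x = {x, fflip G x}"

definition half_edges :: "('f, 'm) embedded_graph_scheme \<Rightarrow> 'f set set" where
  "half_edges G = half_edge G ` flags G"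

definition vertex :: "('f, 'm) embedded_graph_scheme \<Rightarrow> 'f \<Rightarrow> 'f set" where
  "vertex G x =
     ({(y, eflip G y) | y. y \<in> flags G} \<union> {(y, fflip G y) | y. y \<in> flags G})\<^sup>* `` {x}"

definition vertices :: "('f, 'm) embedded_graph_scheme \<Rightarrow> 'f set set" where
  "vertices G = vertex G ` flags G"

definition half_edges_at :: "('f, 'm) embedded_graph_scheme \<Rightarrow> 'f set \<Rightarrow> 'f set set" where
  "half_edges_at G v = {h \<in> half_edges G. h \<subseteq> v}"

text \<open>
  The medial graph may have free loops, i.e. closed curves without vertices: by convention these
  arise from the isolated vertices.
\<close>

record 'f curve_graph = "'f embedded_graph" +
  free_loops :: nat

text \<open>
  An edge \<open>e\<close> of \<open>G\<close> and its dual edge cross in a point, the medial vertex on \<open>e\<close>; the four flags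
  of \<open>e\<close> are the quadrants at this point, in the cyclic order
  \<open>f, vflip f, vflip (fflip f), fflip f\<close>. Each quadrant \<open>f\<close> contains one medial half-edge, which
  continues through the corner of \<open>G\<close> at \<open>f\<close> to the medial half-edge in \<open>eflip f\<close>.
  The medial flag \<open>(f, g)\<close>, with \<open>g\<close> a quadrant adjacent to \<open>f\<close>, is the side of the medial
  half-edge in \<open>f\<close> that faces the one in \<open>g\<close>. The side facing \<open>fflip f\<close> lies in the face of the
  medial graph around a vertex of \<open>G\<close>, the side facing \<open>vflip f\<close> in the one inside a face of \<open>G\<close>.
  The flips are the identity off the flags, so that equality of records is equality of embedded
  graphs.
\<close>

definition medial_flags :: "'f ribbon_graph \<Rightarrow> ('f \<times> 'f) set" where
  "medial_flags G = {(f, g). f \<in> flags G \<and> (g = vflip G f \<or> g = fflip G f)}"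

definition medial :: "'f ribbon_graph \<Rightarrow> ('f \<times> 'f) curve_graph" where
  "medial G = \<lparr>
     flags = medial_flags G,
     vflip = (\<lambda>(f, g).
       if (f, g) \<notin> medial_flags G then (f, g)
       else if g = vflip G f then (eflip G f, vflip G (eflip G f))
       else (eflip G f, fflip G (eflip G f))),
     eflip = (\<lambda>(f, g). if (f, g) \<notin> medial_flags G then (f, g) else (g, f)),
     fflip = (\<lambda>(f, g).
       if (f, g) \<notin> medial_flags G then (f, g)
       else if g = vflip G f then (f, fflip G f)
       else (f, vflip G f)),
     free_loops = isolated G\<rparr>"

definition pairings :: "'a set \<Rightarrow> 'a set set set" where
  "pairings A = {P. partition_on A P \<and> (\<forall>p\<in>P. card p = 2)}"

definition graph_states :: "('f, 'm) embedded_graph_scheme \<Rightarrow> ('f set \<Rightarrow> 'f set set set) set" where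
  "graph_states M = (\<Pi>\<^sub>E v\<in>vertices M. pairings (half_edges_at M v))"

text \<open>A weight system assigns a weight to each unordered pair of half-edges at a common vertex.\<close>

definition state_weight ::
  "('f, 'm) embedded_graph_scheme \<Rightarrow> ('f set set \<Rightarrow> 'a::comm_ring_1) \<Rightarrow>
   ('f set \<Rightarrow> 'f set set set) \<Rightarrow> 'a" where
  "state_weight M W S = (\<Prod>v\<in>vertices M. \<Prod>p\<in>S v. W p)"

text \<open>Half-edges are joined along the edges of \<open>M\<close> and, at the vertices, by the state.\<close>

definition curve_steps ::
  "('f, 'm) embedded_graph_scheme \<Rightarrow> ('f set \<Rightarrow> 'f set set set) \<Rightarrow> 'f set rel" where
  "curve_steps M S =
     {(h, vflip M ` h) | h. h \<in> half_edges M} \<union>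
     {(h, h'). \<exists>v\<in>vertices M. {h, h'} \<in> S v}"

definition num_curves :: "'f curve_graph \<Rightarrow> ('f set \<Rightarrow> 'f set set set) \<Rightarrow> nat" where
  "num_curves M S = card (half_edges M // (curve_steps M S)\<^sup>*) + free_loops M"

definition transition_poly ::
  "'f curve_graph \<Rightarrow> ('f set set \<Rightarrow> 'a::comm_ring_1) \<Rightarrow> 'a \<Rightarrow> 'a" where
  "transition_poly M W t =
     (\<Sum>S\<in>graph_states M. state_weight M W S * t ^ num_curves M S)"

text \<open>
  The sector of the medial graph at \<open>(f, g)\<close> contains at most one half-edge of \<open>G\<close>. It contains
  one precisely when \<open>f\<close> and \<open>g\<close> are the two flags of a half-edge of \<open>G\<close>, because that half-edge
  separates the quadrants \<open>f\<close> and \<open>g\<close>.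
\<close>

definition half_edge_between :: "'f ribbon_graph \<Rightarrow> 'f \<times> 'f \<Rightarrow> bool" where
  "half_edge_between G x \<longleftrightarrow> {fst x, snd x} \<in> half_edges G"

text \<open>
  The parameters \<open>a\<close> and \<open>b\<close> stand for the square roots of \<open>\<alpha>\<close> and \<open>\<beta>\<close>. The half-edges of a
  flag \<open>x\<close> and of \<open>eflip x\<close> are consecutive in the rotation at their vertex, and \<open>x\<close> and \<open>eflip x\<close>
  are the two flags of the sector between them.
\<close>

definition medial_weights ::
  "'f ribbon_graph \<Rightarrow> 'a \<Rightarrow> 'a \<Rightarrow> ('f \<times> 'f) set set \<Rightarrow> 'a::comm_ring_1" where
  "medial_weights G a b p =
     (if \<exists>x\<in>flags (medial G).
           p = {half_edge (medial G) x, half_edge (medial G) (eflip (medial G) x)} \<and>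
           \<not> half_edge_between G x
      then a
      else if \<exists>x\<in>flags (medial G).
           p = {half_edge (medial G) x, half_edge (medial G) (eflip (medial G) x)} \<and>
           half_edge_between G x
      then b
      else 0)"

definition dual_medial_weights ::
  "'f ribbon_graph \<Rightarrow> 'a \<Rightarrow> 'a \<Rightarrow> ('f \<times> 'f) set set \<Rightarrow> 'a::comm_ring_1" where
  "dual_medial_weights G a b = medial_weights G b a"

end

theory Submission
  imports Defs
begin

text \<open>Passing to the dual exchanges \<open>vflip\<close> and \<open>fflip\<close>. The
  construction of the medial graph is symmetric under this exchange, so \<open>medial_dual\<close>
  gives equality of records, and both sides sum over the same states with the same curve counts.
  Only the weights differ. Around a medial vertex, half-edges of the graph and of its dual
  alternate, so each sector contains a half-edge of exactly one of them
  (\<open>half_edge_between_dual\<close>). Hence the weights of consecutive pairs are swapped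
  (\<open>medial_weights_dual\<close>), and the sums agree term by term.\<close>

context embedded_graph
begin

lemma fflip_pair_neq_vflip_pair:
  assumes "x \<in> flags G" "y \<in> flags G"
  shows "{x, fflip G x} \<noteq> {y, vflip G y}"
proof
  assume "{x, fflip G x} = {y, vflip G y}"
  then have "fflip G x = vflip G x"
    using vflip_vflip[OF assms(2)] by (auto simp: doubleton_eq_iff)
  then show False
    using vflip_neq_fflip[OF assms(1)] by simp
qed

end

lemma medial_flags_dual: "medial_flags (dual G) = medial_flags G"
  by (auto simp: medial_flags_def dual_def)

text \<open>Duality reverses the order of the case distinctions in the flips. This is harmless: on a
  medial flag exactly one of the two cases holds, since \<open>vflip G f \<noteq> fflip G f\<close>,
  and off the flags both sides are the identity.\<close>

lemma medial_dual:
  assumes "embedded_graph G"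
  shows "medial (dual G) = medial G"
proof -
  interpret embedded_graph G by fact
  show ?thesis
    unfolding medial_def medial_flags_dual
    by (auto simp: dual_def medial_flags_def fun_eq_iff dest: vflip_neq_fflip)
qed

text \<open>A half-edge of \<open>G\<close> equal to \<open>{f, g}\<close> might a priori come from
  a flag other than \<open>f\<close>; \<open>fflip_pair_neq_vflip_pair\<close> rules this out when
  \<open>g = vflip G f\<close>.\<close>

lemma half_edge_between_iff:
  assumes "embedded_graph G" and "(f, g) \<in> medial_flags G"
  shows "half_edge_between G (f, g) \<longleftrightarrow> g = fflip G f"
proof -
  interpret embedded_graph G by fact
  have f: "f \<in> flags G" and g: "g = vflip G f \<or> g = fflip G f"
    using assms(2) by (auto simp: medial_flags_def)
  have "half_edge_between G (f, g) \<longleftrightarrow> (\<exists>x\<in>flags G. {x, fflip G x} = {f, g})"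
    by (auto simp: half_edge_between_def half_edges_def half_edge_def)
  then show ?thesis
    using f g fflip_pair_neq_vflip_pair[OF _ f] by blast
qed

lemma embedded_graph_dual:
  assumes "embedded_graph G"
  shows "embedded_graph (dual G)"
proof -
  interpret embedded_graph G by fact
  show ?thesis
    by unfold_locales
      (auto simp: dual_def finite_flags vflip_flags eflip_flags fflip_flags vflip_vflip
        eflip_eflip fflip_fflip vflip_neq eflip_neq fflip_neq vflip_fflip
        vflip_neq_fflip[symmetric])
qed

text \<open>The two kinds of medial flag, \<open>g = fflip G f\<close> and
  \<open>g = vflip G f\<close>, are exclusive and exhaustive, and duality interchanges them.\<close>

lemma half_edge_between_dual:
  assumes "embedded_graph G" and "x \<in> flags (medial G)"
  shows "half_edge_between (dual G) x \<longleftrightarrow> \<not> half_edge_between G x"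
proof -
  interpret embedded_graph G by fact
  obtain f g where x: "x = (f, g)" "(f, g) \<in> medial_flags G"
    using assms(2) by (cases x) (auto simp: medial_def)
  have "half_edge_between (dual G) x \<longleftrightarrow> g = vflip G f"
    using half_edge_between_iff[OF embedded_graph_dual[OF assms(1)], of f g] x
    by (simp add: medial_flags_dual) (simp add: dual_def)
  then show ?thesis
    using x half_edge_between_iff[OF assms(1) x(2)] vflip_neq_fflip[of f]
    by (auto simp: medial_flags_def)
qed

lemma fst_image_medial_half_edge: "fst ` half_edge (medial G) x = {fst x}"
  by (cases x) (auto simp: half_edge_def medial_def)

lemma fst_eflip_medial: "x \<in> flags (medial G) \<Longrightarrow> fst (eflip (medial G) x) = snd x"
  by (cases x) (auto simp: medial_def)

text \<open>A consecutive pair of half-edges determines the two quadrants containing them.\<close>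

lemma half_edge_between_cong:
  assumes "x \<in> flags (medial G)" "y \<in> flags (medial G)"
    and "{half_edge (medial G) x, half_edge (medial G) (eflip (medial G) x)} =
      {half_edge (medial G) y, half_edge (medial G) (eflip (medial G) y)}"
  shows "half_edge_between G x \<longleftrightarrow> half_edge_between G y"
proof -
  \<comment> \<open>All flags of a medial half-edge have its quadrant as first component, so
    projecting by \<open>fst\<close> recovers the two quadrants from the pair.\<close>
  have "{{fst x}, {snd x}} = {{fst y}, {snd y}}"
    using arg_cong[OF assms(3), of "(`) ((`) fst)"] assms(1,2)
    by (simp add: fst_image_medial_half_edge fst_eflip_medial)
  then have "{fst x, snd x} = {fst y, snd y}"
    by (auto simp: doubleton_eq_iff)
  then show ?thesis
    by (simp add: half_edge_between_def)
qed

lemma medial_weights_dual: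
  assumes "embedded_graph G"
  shows "medial_weights (dual G) a b = dual_medial_weights G a b"
proof
  fix p
  define sec where "sec x \<longleftrightarrow> x \<in> flags (medial G) \<and>
    p = {half_edge (medial G) x, half_edge (medial G) (eflip (medial G) x)}" for x
  have between: "half_edge_between (dual G) x \<longleftrightarrow> \<not> half_edge_between G x" if "sec x" for x
    using that half_edge_between_dual[OF assms] by (simp add: sec_def)
  have unique: "half_edge_between G x \<longleftrightarrow> half_edge_between G y" if "sec x" "sec y" for x y
    using that half_edge_between_cong[of x G y] unfolding sec_def by blast
  \<comment> \<open>As the medial graphs coincide, one predicate \<open>sec\<close> describes the
    sectors of \<open>p\<close> for both \<open>G\<close> and its dual.\<close>
  have weights: "medial_weights H c d p =
      (if \<exists>x. sec x \<and> \<not> half_edge_between H x then c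
       else if \<exists>x. sec x \<and> half_edge_between H x then d else 0)"
    if "medial H = medial G" for H and c d :: 'b
    unfolding medial_weights_def sec_def that Bex_def by (simp only: conj_assoc)
  \<comment> \<open>By \<open>unique\<close> all sectors with pair \<open>p\<close> are of the same
    kind, so at most one branch condition holds and the precedence of the first branch does not
    matter; \<open>between\<close> then swaps the branches. Without a sector, both weights are
    0.\<close>
  show "medial_weights (dual G) a b p = dual_medial_weights G a b p"
    unfolding dual_medial_weights_def weights[OF medial_dual[OF assms]] weights[OF refl]
    by (smt (verit) between unique)
qed

theorem theorem5p1:
  fixes G :: "'f ribbon_graph"
    and \<alpha> \<beta> sqrt_\<alpha> sqrt_\<beta> t :: "'a :: comm_ring_1"
  assumes "embedded_graph G"
    and "sqrt_\<alpha>\<^sup>2 = \<alpha>" and "sqrt_\<beta>\<^sup>2 = \<beta>"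
  shows "medial (dual G) = medial G \<and>
    transition_poly (medial (dual G)) (medial_weights (dual G) sqrt_\<alpha> sqrt_\<beta>) t =
    transition_poly (medial G) (dual_medial_weights G sqrt_\<alpha> sqrt_\<beta>) t"
  using assms(1) by (simp add: medial_dual medial_weights_dual)

end
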